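(* Suppose the dual objective $\mathbf D:\mathbb{R}^{n+m}\to\mathbb{R}$ of the unbalanced optimal transport (UOT) problem is $\mathbf L$-blockwise strongly concave, let $\hat{\boldsymbol\theta}$ be the optimal dual solution, i.e. a maximizer of $\mathbf D$ over the dual feasible region $\mathcal R^D$, let $\tilde{\boldsymbol\theta}\in\mathcal R^D$, and let $\boldsymbol t\in\mathbb{R}^{nm}_+$ be a primal variable. Then $\hat{\boldsymbol\theta}$ belongs to the ellipse region $$\mathcal R^G(\tilde{\boldsymbol\theta})=\left\{\boldsymbol\theta\in\mathbb{R}^{n+m}:\ (\boldsymbol\theta-\tilde{\boldsymbol\theta})^T\mathbf L(\boldsymbol\theta-\tilde{\boldsymbol\theta})\le 2\operatorname{Gap}(\boldsymbol t,\tilde{\boldsymbol\theta})\right\}.$$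
   Context: Let $m,n\ge1$, $\lambda>0$, a cost vector $\boldsymbol c\in\mathbb{R}^{nm}_+$ and $\boldsymbol y\in\mathbb{R}^{m+n}$ be given. All indices start at $0$. A transport matrix $\mathbf T\in\mathbb{R}^{m\times n}_+$ is flattened row by row into $\boldsymbol t\in\mathbb{R}^{nm}_+$ ($t_{un+v}=T_{u,v}$), and the cost matrix into $\boldsymbol c$ likewise. The index matrix $\mathbf X\in\{0,1\}^{(m+n)\times nm}$ is such that $\mathbf X\boldsymbol t$ lists the $m$ row sums followed by the $n$ column sums of $\mathbf T$; its $p$-th column $\boldsymbol x_p$, $p=un+v$, has exactly two entries equal to $1$, at positions $u$ and $m+v$. The primal UOT objective is $\mathbf P(\boldsymbol t)=\lambda\boldsymbol c^T\boldsymbol t+D_\phi(\mathbf X\boldsymbol t,\boldsymbol y)$ for $\boldsymbol t\in\mathbb{R}^{nm}_+$, where $D_\phi(\cdot,\boldsymbol y)$ is a proper convex penalty (a divergence in its first argument) with convex conjugate $D_\phi^*(\boldsymbol\theta)=\sup_{\boldsymbol z}(\boldsymbol\theta^T\boldsymbol z-D_\phi(\boldsymbol z,\boldsymbol y))$. The dual objective is $\mathbf D(\boldsymbol\theta)=-D_\phi^*(-\boldsymbol\theta)$ and the dual feasible region is $\mathcal R^D=\{\boldsymbol\theta\in\mathbb{R}^{m+n}:\boldsymbol x_p^T\boldsymbol\theta-\lambda c_p\le0\ \text{for all } 0\le p<nm\}$. The duality gap is $\operatorname{Gap}(\boldsymbol t,\boldsymbol\theta)=\mathbf P(\boldsymbol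 t)-\mathbf D(\boldsymbol\theta)$. A differentiable function $f$ is $\mathbf L$-blockwise strongly concave, for a diagonal positive-definite matrix $\mathbf L$, if $f(\boldsymbol w)\le f(\boldsymbol x)+\nabla f(\boldsymbol x)^T(\boldsymbol w-\boldsymbol x)-\frac12(\boldsymbol w-\boldsymbol x)^T\mathbf L(\boldsymbol w-\boldsymbol x)$ for all $\boldsymbol x,\boldsymbol w$. *)

theory Defs
  imports "HOL-Analysis.Analysis"
begin

(* The sizes m and n are CARD('m) and CARD('n).  R^(nm) is indexed by pairs (u, v), standing for
   the flat position u*n + v, and R^(m+n) by a disjoint sum: Inl u stands for position u,
   Inr v for position m + v. *)

definition index_matrix :: "real ^ ('m::finite \<times> 'n::finite) ^ ('m + 'n)" where
  "index_matrix = (\<chi> i p. case i of Inl u \<Rightarrow> of_bool (u = fst p) | Inr v \<Rightarrow> of_bool (v = snd p))"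

lemma column_index_matrix:
  "column (u, v) index_matrix = axis (Inl u) 1 + axis (Inr v) 1"
  by (auto simp: vec_eq_iff column_def index_matrix_def axis_def split: sum.splits)

lemma index_matrix_row_sums:
  fixes T :: "real ^ 'n::finite ^ 'm::finite"
  shows "(index_matrix *v (\<chi> p. T $ fst p $ snd p)) $ Inl u = (\<Sum>v\<in>UNIV. T $ u $ v)"
proof -
  have "(index_matrix *v (\<chi> p. T $ fst p $ snd p)) $ Inl u
      = (\<Sum>(a, b)\<in>UNIV \<times> UNIV. of_bool (u = a) * T $ a $ b)"
    by (simp add: index_matrix_def matrix_vector_mult_def case_prod_unfold)
  also have "\<dots> = (\<Sum>b\<in>UNIV. \<Sum>a\<in>UNIV. of_bool (u = a) * T $ a $ b)"
    unfolding sum.cartesian_product[symmetric] by (rule sum.swap)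
  also have "\<dots> = (\<Sum>v\<in>UNIV. T $ u $ v)"
    by simp
  finally show ?thesis .
qed

lemma index_matrix_column_sums:
  fixes T :: "real ^ 'n::finite ^ 'm::finite"
  shows "(index_matrix *v (\<chi> p. T $ fst p $ snd p)) $ Inr v = (\<Sum>u\<in>UNIV. T $ u $ v)"
proof -
  have "(index_matrix *v (\<chi> p. T $ fst p $ snd p)) $ Inr v
      = (\<Sum>(a, b)\<in>UNIV \<times> UNIV. of_bool (v = b) * T $ a $ b)"
    by (simp add: index_matrix_def matrix_vector_mult_def case_prod_unfold)
  also have "\<dots> = (\<Sum>u\<in>UNIV. T $ u $ v)"
    unfolding sum.cartesian_product[symmetric] by simp
  finally show ?thesis .
qed

(* Penalties take values in the extended reals, so that an implicit domain (such as z >= 0 for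
   Kullback-Leibler, or a hard constraint) is encoded by the value infinity. *)

definition proper_convex :: "('a::real_vector \<Rightarrow> ereal) \<Rightarrow> bool" where
  "proper_convex f \<longleftrightarrow>
     (\<forall>z. f z \<noteq> -\<infinity>) \<and> (\<exists>z. f z \<noteq> \<infinity>) \<and> convex {(z, a). f z \<le> ereal a}"

definition convex_conjugate :: "('a::real_inner \<Rightarrow> ereal) \<Rightarrow> 'a \<Rightarrow> ereal" where
  "convex_conjugate f \<theta> = (SUP z. ereal (\<theta> \<bullet> z) - f z)"

definition primal_objective ::
  "real \<Rightarrow> real ^ ('m::finite \<times> 'n::finite) \<Rightarrow>
   (real ^ ('m + 'n) \<Rightarrow> real ^ ('m + 'n) \<Rightarrow> ereal) \<Rightarrow> real ^ ('m + 'n) \<Rightarrow>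
   real ^ ('m \<times> 'n) \<Rightarrow> ereal" where
  "primal_objective lam c Dphi y t = ereal (lam * (c \<bullet> t)) + Dphi (index_matrix *v t) y"

definition dual_objective ::
  "(real ^ ('m::finite + 'n::finite) \<Rightarrow> real ^ ('m + 'n) \<Rightarrow> ereal) \<Rightarrow> real ^ ('m + 'n) \<Rightarrow>
   real ^ ('m + 'n) \<Rightarrow> ereal" where
  "dual_objective Dphi y \<theta> = - convex_conjugate (\<lambda>z. Dphi z y) (- \<theta>)"

definition dual_feasible ::
  "real \<Rightarrow> real ^ ('m::finite \<times> 'n::finite) \<Rightarrow> (real ^ ('m + 'n)) set" where
  "dual_feasible lam c = {\<theta>. \<forall>p. column p index_matrix \<bullet> \<theta> - lam * c $ p \<le> 0}"

definition duality_gap ::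
  "real \<Rightarrow> real ^ ('m::finite \<times> 'n::finite) \<Rightarrow>
   (real ^ ('m + 'n) \<Rightarrow> real ^ ('m + 'n) \<Rightarrow> ereal) \<Rightarrow> real ^ ('m + 'n) \<Rightarrow>
   real ^ ('m \<times> 'n) \<Rightarrow> real ^ ('m + 'n) \<Rightarrow> ereal" where
  "duality_gap lam c Dphi y t \<theta> = primal_objective lam c Dphi y t - dual_objective Dphi y \<theta>"

definition diagonal_pos_def :: "real ^ 'k ^ 'k::finite \<Rightarrow> bool" where
  "diagonal_pos_def L \<longleftrightarrow>
     (\<forall>i j. i \<noteq> j \<longrightarrow> L $ i $ j = 0) \<and> (\<forall>x. x \<noteq> 0 \<longrightarrow> x \<bullet> (L *v x) > 0)"

definition blockwise_strongly_concave ::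
  "real ^ 'k ^ 'k::finite \<Rightarrow> (real ^ 'k \<Rightarrow> real) \<Rightarrow> bool" where
  "blockwise_strongly_concave L f \<longleftrightarrow> diagonal_pos_def L \<and>
     (\<exists>grad. (\<forall>x. GDERIV f x :> grad x) \<and>
        (\<forall>x w. f w \<le> f x + grad x \<bullet> (w - x) - 1 / 2 * ((w - x) \<bullet> (L *v (w - x)))))"

definition ellipse_region ::
  "real \<Rightarrow> real ^ ('m::finite \<times> 'n::finite) \<Rightarrow>
   (real ^ ('m + 'n) \<Rightarrow> real ^ ('m + 'n) \<Rightarrow> ereal) \<Rightarrow> real ^ ('m + 'n) \<Rightarrow>
   real ^ ('m + 'n) ^ ('m + 'n) \<Rightarrow> real ^ ('m \<times> 'n) \<Rightarrow> real ^ ('m + 'n) \<Rightarrow>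
   (real ^ ('m + 'n)) set" where
  "ellipse_region lam c Dphi y L t \<theta>' =
     {\<theta>. ereal ((\<theta> - \<theta>') \<bullet> (L *v (\<theta> - \<theta>'))) \<le> 2 * duality_gap lam c Dphi y t \<theta>'}"

end

theory Submission
  imports Defs
begin

text \<open>
  Two facts carry the proof. First, a strongly concave function grows at least quadratically away
  from its maximizer on a convex set: half of the \<open>L\<close>-norm squared of
  \<open>\<theta>_hat - \<theta>_tilde\<close> is at most \<open>D \<theta>_hat - D \<theta>_tilde\<close>
  (\<open>quadratic_growth_at_maximizer\<close>). The dual feasible region is convex, being an
  intersection of half-spaces. Second, weak duality (\<open>weak_duality\<close>) bounds the unknown
  optimal value \<open>D \<theta>_hat\<close> by the primal value at any nonnegative \<open>t\<close>, so the
  difference above is at most the duality gap at \<open>(t, \<theta>_tilde)\<close>.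

  The growth estimate uses strong concavity only along the segment between the two points, and so
  avoids the first-order optimality condition: comparing the values at the ends of the segment with
  a point close to the maximizer leaves only a limit over a real parameter.
\<close>

text \<open>
  The gradient bound, applied at the intermediate point towards each end of the segment and
  averaged with the weights of that point, loses its linear terms because they cancel.
\<close>
lemma blockwise_strongly_concave_segment:
  fixes L :: "real ^ 'k ^ 'k::finite"
  assumes "blockwise_strongly_concave L f" and "0 \<le> s" "s \<le> 1"
  shows "(1 - s) * f a + s * f b + s * (1 - s) / 2 * ((a - b) \<bullet> (L *v (a - b)))
    \<le> f ((1 - s) *\<^sub>R a + s *\<^sub>R b)"
proof -
  obtain grad where grad:
    "f w \<le> f x + grad x \<bullet> (w - x) - 1 / 2 * ((w - x) \<bullet> (L *v (w - x)))" for x w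
    using assms(1) unfolding blockwise_strongly_concave_def by blast
  define x where "x = (1 - s) *\<^sub>R a + s *\<^sub>R b"
  define q where "q = (a - b) \<bullet> (L *v (a - b))"
  define l where "l = grad x \<bullet> (a - b)"
  have ax: "a - x = s *\<^sub>R (a - b)" and bx: "b - x = (s - 1) *\<^sub>R (a - b)"
    by (simp_all add: x_def algebra_simps)
  have "f a \<le> f x + s * l - s\<^sup>2 / 2 * q"
    using grad[of a x] unfolding ax
    by (simp add: l_def q_def matrix_vector_mult_scaleR power2_eq_square)
  then have A: "(1 - s) * f a \<le> (1 - s) * (f x + s * l - s\<^sup>2 / 2 * q)"
    using assms(3) by (intro mult_left_mono) auto
  have "f b \<le> f x + (s - 1) * l - (s - 1)\<^sup>2 / 2 * q"
    using grad[of b x] unfolding bx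
    by (simp add: l_def q_def matrix_vector_mult_scaleR power2_eq_square)
  then have B: "s * f b \<le> s * (f x + (s - 1) * l - (s - 1)\<^sup>2 / 2 * q)"
    using assms(2) by (rule mult_left_mono)
  have "(1 - s) * (f x + s * l - s\<^sup>2 / 2 * q) + s * (f x + (s - 1) * l - (s - 1)\<^sup>2 / 2 * q)
      = f x - s * (1 - s) / 2 * q"
    by (simp add: field_simps power2_eq_square)
  with A B show ?thesis
    unfolding x_def[symmetric] q_def[symmetric] by linarith
qed

text \<open>
  By maximality of \<open>a\<close>, the segment inequality holds with \<open>f a\<close> on its
  right-hand side. Dividing it by the positive weight \<open>1 - r\<close> of \<open>b\<close> gives the
  claim up to the factor \<open>r\<close>, the weight of \<open>a\<close>, which may be taken arbitrarily
  close to \<open>1\<close>.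
\<close>
lemma quadratic_growth_at_maximizer:
  fixes L :: "real ^ 'k ^ 'k::finite"
  assumes "blockwise_strongly_concave L f" and "convex S"
    and "a \<in> S" and max: "\<And>x. x \<in> S \<Longrightarrow> f x \<le> f a" and "b \<in> S"
  shows "(a - b) \<bullet> (L *v (a - b)) \<le> 2 * (f a - f b)"
proof (rule field_le_mult_one_interval)
  fix r :: real
  assume r: "0 < r" "r < 1"
  define q where "q = (a - b) \<bullet> (L *v (a - b))"
  have "(1 - (1 - r)) *\<^sub>R a + (1 - r) *\<^sub>R b \<in> S"
    using assms(2,3,5) r by (intro convexD) auto
  then have "r * f a + (1 - r) * f b + (1 - r) * r / 2 * q \<le> f a"
    using blockwise_strongly_concave_segment[OF assms(1), of "1 - r" a b] max r
    unfolding q_def by fastforce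
  then have "(1 - r) * (r * q) \<le> (1 - r) * (2 * (f a - f b))"
    by (simp add: field_simps)
  then show "r * q \<le> 2 * (f a - f b)"
    using r by simp
qed

lemma convex_dual_feasible: "convex (dual_feasible lam c)"
proof -
  have "dual_feasible lam c = (\<Inter>p. {\<theta>. column p index_matrix \<bullet> \<theta> \<le> lam * c $ p})"
    by (auto simp: dual_feasible_def)
  then show ?thesis
    by (simp add: convex_INT convex_halfspace_le)
qed

lemma inner_matrix_vector_mult_columns:
  fixes A :: "real ^ 'p::finite ^ 'k::finite"
  shows "x \<bullet> (A *v t) = (\<Sum>p\<in>UNIV. t $ p * (column p A \<bullet> x))"
  by (simp add: matrix_mult_sum scalar_mult_eq_scaleR inner_sum_right inner_commute)

text \<open>
  The Fenchel--Young inequality at \<open>z = X t\<close> leaves the term \<open>\<theta> \<bullet> X t\<close>, which the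
  dual constraints, weighted by the entries of \<open>t\<close>, bound by the transport cost.
\<close>
lemma weak_duality:
  assumes "\<theta> \<in> dual_feasible lam c" and "\<forall>p. t $ p \<ge> 0"
  shows "dual_objective Dphi y \<theta> \<le> primal_objective lam c Dphi y t"
proof -
  let ?z = "index_matrix *v t"
  have "\<theta> \<bullet> ?z \<le> (\<Sum>p\<in>UNIV. t $ p * (lam * c $ p))"
    unfolding inner_matrix_vector_mult_columns
    using assms by (intro sum_mono mult_left_mono) (auto simp: dual_feasible_def)
  also have "\<dots> = lam * (c \<bullet> t)"
    by (simp add: inner_vec_def sum_distrib_left mult_ac)
  finally have cost: "\<theta> \<bullet> ?z \<le> lam * (c \<bullet> t)" .
  have "ereal (- \<theta> \<bullet> ?z) - Dphi ?z y \<le> convex_conjugate (\<lambda>z. Dphi z y) (- \<theta>)"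
    unfolding convex_conjugate_def by (rule SUP_upper) simp
  then have "dual_objective Dphi y \<theta> \<le> - (ereal (- \<theta> \<bullet> ?z) - Dphi ?z y)"
    by (simp add: dual_objective_def)
  also have "\<dots> = ereal (\<theta> \<bullet> ?z) + Dphi ?z y"
    by (cases "Dphi ?z y") auto
  also have "\<dots> \<le> primal_objective lam c Dphi y t"
    unfolding primal_objective_def using cost by (intro add_right_mono) simp
  finally show ?thesis .
qed

theorem theorem8:
  fixes lam :: real
    and c t :: "real ^ ('m::finite \<times> 'n::finite)"
    and y \<theta>_hat \<theta>_tilde :: "real ^ ('m + 'n)"
    and Dphi :: "real ^ ('m + 'n) \<Rightarrow> real ^ ('m + 'n) \<Rightarrow> ereal"
    and L :: "real ^ ('m + 'n) ^ ('m + 'n)"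
  assumes "lam > 0"
    and "\<forall>p. c $ p \<ge> 0"
    and "proper_convex (\<lambda>z. Dphi z y)"
    and "\<forall>\<theta>. \<bar>dual_objective Dphi y \<theta>\<bar> \<noteq> \<infinity>"
    and "blockwise_strongly_concave L (\<lambda>\<theta>. real_of_ereal (dual_objective Dphi y \<theta>))"
    and "is_arg_max (dual_objective Dphi y) (\<lambda>\<theta>. \<theta> \<in> dual_feasible lam c) \<theta>_hat"
    and "\<theta>_tilde \<in> dual_feasible lam c"
    and "\<forall>p. t $ p \<ge> 0"
  shows "\<theta>_hat \<in> ellipse_region lam c Dphi y L t \<theta>_tilde"
proof -
  let ?D = "dual_objective Dphi y"
  let ?P = "primal_objective lam c Dphi y t"
  define f where "f = (\<lambda>\<theta>. real_of_ereal (?D \<theta>))"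
  define q where "q = (\<theta>_hat - \<theta>_tilde) \<bullet> (L *v (\<theta>_hat - \<theta>_tilde))"
  have fin: "?D \<theta> = ereal (f \<theta>)" for \<theta>
    using assms(4) by (simp add: ereal_real f_def)
  have hat: "\<theta>_hat \<in> dual_feasible lam c"
    using assms(6) by (simp add: is_arg_max_linorder)
  have max: "f \<theta> \<le> f \<theta>_hat" if "\<theta> \<in> dual_feasible lam c" for \<theta>
    using assms(6) that by (simp add: is_arg_max_linorder fin)
  have concave: "blockwise_strongly_concave L f"
    using assms(5) by (simp add: f_def)
  have growth: "q \<le> 2 * (f \<theta>_hat - f \<theta>_tilde)"
    unfolding q_def
    by (rule quadratic_growth_at_maximizer[OF concave convex_dual_feasible hat _ assms(7)])
      (fact max)
  have "ereal (f \<theta>_hat) \<le> ?P"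
    using weak_duality[OF hat assms(8), of Dphi y] by (simp only: fin)
  with growth have "ereal q \<le> 2 * (?P - ereal (f \<theta>_tilde))"
    by (cases ?P) auto
  then show ?thesis
    by (simp add: ellipse_region_def duality_gap_def q_def fin)
qed

end
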